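(* Let $F$ be a Boolean CNF formula on $n$ variables, let $\varepsilon>0$, and suppose $|\mathsf{sol}(F)|\ge \mathsf{thresh}$. Let $X$ be the random value returned by one invocation of the procedure RoundMCCore (defined in the context) on $F$ with tolerance $\varepsilon$. Let $L$ be the event $X<\frac{|\mathsf{sol}(F)|}{1+\varepsilon}$ and $U$ the event $X>(1+\varepsilon)|\mathsf{sol}(F)|$. Then $$\Pr[L]\le\begin{cases}0.262 & \text{if } \varepsilon<\sqrt2-1\\ 0.157 & \text{if } \sqrt2-1\le\varepsilon<1\\ 0.085 & \text{if } 1\le\varepsilon<3\\ 0.055 & \text{if } 3\le\varepsilon<4\sqrt2-1\\ 0.023 & \text{if } \varepsilon\ge 4\sqrt2-1\end{cases}\qquad\text{and}\qquad \Pr[U]\le\begin{cases}0.169 & \text{if }\varepsilon<3\\ 0.044 & \text{if }\varepsilon\ge3.\end{cases}$$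
   Context: $\mathsf{sol}(F)\subseteq\{0,1\}^n$ is the set of satisfying assignments of $F$. $\mathsf{pivot}=9.84\left(1+\frac1\varepsilon\right)^2$ and $\mathsf{thresh}=9.84\left(1+\frac{\varepsilon}{1+\varepsilon}\right)\left(1+\frac1\varepsilon\right)^2$. $\mathcal H(n,n)$ is a strongly 2-universal family of functions $h:\{0,1\}^n\to\{0,1\}^n$: for $h$ uniform in $\mathcal H(n,n)$, all distinct $x,y\in\{0,1\}^n$ and all $\alpha,\beta\in\{0,1\}^n$, $\Pr[h(x)=\alpha]=2^{-n}$ and $\Pr[h(x)=\alpha\wedge h(y)=\beta]=2^{-2n}$. For $1\le m\le n$, $h^{(m)}(y)$ and $\alpha^{(m)}$ denote the first $m$ coordinates of $h(y)$ and of $\alpha\in\{0,1\}^n$. Set $\mathsf{Cnt}_m=|\{y\in\mathsf{sol}(F): h^{(m)}(y)=\alpha^{(m)}\}|$ for $1\le m\le n$ and $\mathsf{Cnt}_0=|\mathsf{sol}(F)|$. One invocation of RoundMCCore: choose $h$ uniformly from $\mathcal H(n,n)$ and, independently, $\alpha$ uniformly from $\{0,1\}^n$. Let $m$ be the unique index in $\{1,\dots,n\}$ with $\mathsf{Cnt}_{m-1}\ge\mathsf{thresh}$ and $\mathsf{Cnt}_m<\mathsf{thresh}$ (if there is none, i.e. $\mathsf{Cnt}_n\ge \mathsf{thresh}$, put $m=n$). Let $c$ be the number of elements of the cell $\{y\in\mathsf{sol}(F):h^{(m)}(y)=\alpha^{(m)}\}$ enumerated, stopping after $\lceil\mathsf{thresh}\rceil$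 elements; so $c=\mathsf{Cnt}_m$ whenever $\mathsf{Cnt}_m<\mathsf{thresh}$. The pair $(\mathsf{roundUp},\mathsf{roundValue})$ is: $(1,\frac{\sqrt{1+2\varepsilon}}{2}\mathsf{pivot})$ if $\varepsilon<\sqrt2-1$; $(1,\frac{\mathsf{pivot}}{\sqrt2})$ if $\sqrt2-1\le\varepsilon<1$; $(1,\mathsf{pivot})$ if $1\le\varepsilon<3$; $(0,\mathsf{pivot})$ if $3\le\varepsilon<4\sqrt2-1$; $(0,\sqrt2\,\mathsf{pivot})$ if $\varepsilon\ge4\sqrt2-1$. If $\mathsf{roundUp}=1$ the procedure returns $X=2^m\cdot\max\{c,\mathsf{roundValue}\}$; if $\mathsf{roundUp}=0$ it returns $X=2^m\cdot\mathsf{roundValue}$. *)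

theory Defs
  imports "HOL-Probability.Probability"
begin

datatype literal = Pos nat | Neg nat

type_synonym cnf = "literal list list"

fun var_of :: "literal \<Rightarrow> nat" where
  "var_of (Pos i) = i"
| "var_of (Neg i) = i"

fun lit_true :: "bool list \<Rightarrow> literal \<Rightarrow> bool" where
  "lit_true x (Pos i) = x ! i"
| "lit_true x (Neg i) = (\<not> x ! i)"

definition cnf_on :: "nat \<Rightarrow> cnf \<Rightarrow> bool" where
  "cnf_on n F \<longleftrightarrow> (\<forall>C\<in>set F. \<forall>l\<in>set C. var_of l < n)"

definition bits :: "nat \<Rightarrow> bool list set" where
  "bits n = {x. length x = n}"

definition sol :: "nat \<Rightarrow> cnf \<Rightarrow> bool list set" where
  "sol n F = {x \<in> bits n. \<forall>C\<in>set F. \<exists>l\<in>set C. lit_true x l}"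

definition pivot :: "real \<Rightarrow> real" where
  "pivot \<epsilon> = 9.84 * (1 + 1 / \<epsilon>)\<^sup>2"

definition thresh :: "real \<Rightarrow> real" where
  "thresh \<epsilon> = 9.84 * (1 + \<epsilon> / (1 + \<epsilon>)) * (1 + 1 / \<epsilon>)\<^sup>2"

text \<open>Using extensional functions, distinct members of \<open>H\<close> differ on \<open>bits n\<close>, and \<open>H\<close> is finite.\<close>

definition strongly_2_universal :: "nat \<Rightarrow> (bool list \<Rightarrow> bool list) set \<Rightarrow> bool" where
  "strongly_2_universal n H \<longleftrightarrow>
     H \<noteq> {} \<and> H \<subseteq> bits n \<rightarrow>\<^sub>E bits n \<and>
     (\<forall>x\<in>bits n. \<forall>y\<in>bits n. x \<noteq> y \<longrightarrow> (\<forall>\<alpha>\<in>bits n. \<forall>\<beta>\<in>bits n.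
        measure_pmf.prob (pmf_of_set H) {h. h x = \<alpha>} = 1 / 2 ^ n \<and>
        measure_pmf.prob (pmf_of_set H) {h. h x = \<alpha> \<and> h y = \<beta>} = 1 / 2 ^ (2 * n)))"

text \<open>For \<open>m = 0\<close> the constraint is void, so the cell is all of \<open>sol n F\<close>.\<close>

definition cell ::
  "nat \<Rightarrow> cnf \<Rightarrow> (bool list \<Rightarrow> bool list) \<Rightarrow> bool list \<Rightarrow> nat \<Rightarrow> bool list set" where
  "cell n F h \<alpha> m = {y \<in> sol n F. take m (h y) = take m \<alpha>}"

definition Cnt ::
  "nat \<Rightarrow> cnf \<Rightarrow> (bool list \<Rightarrow> bool list) \<Rightarrow> bool list \<Rightarrow> nat \<Rightarrow> nat" where
  "Cnt n F h \<alpha> m = card (cell n F h \<alpha> m)"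

definition is_crossing ::
  "nat \<Rightarrow> cnf \<Rightarrow> real \<Rightarrow> (bool list \<Rightarrow> bool list) \<Rightarrow> bool list \<Rightarrow> nat \<Rightarrow> bool" where
  "is_crossing n F \<epsilon> h \<alpha> m \<longleftrightarrow>
     m \<in> {1..n} \<and> real (Cnt n F h \<alpha> (m - 1)) \<ge> thresh \<epsilon> \<and> real (Cnt n F h \<alpha> m) < thresh \<epsilon>"

definition chosen_m ::
  "nat \<Rightarrow> cnf \<Rightarrow> real \<Rightarrow> (bool list \<Rightarrow> bool list) \<Rightarrow> bool list \<Rightarrow> nat" where
  "chosen_m n F \<epsilon> h \<alpha> =
     (if \<exists>m. is_crossing n F \<epsilon> h \<alpha> m then THE m. is_crossing n F \<epsilon> h \<alpha> m else n)"

text \<open>The size of the enumeration of the chosen cell, cut off after \<open>\<lceil>thresh \<epsilon>\<rceil>\<close> elements.\<close>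

definition enum_count ::
  "nat \<Rightarrow> cnf \<Rightarrow> real \<Rightarrow> (bool list \<Rightarrow> bool list) \<Rightarrow> bool list \<Rightarrow> nat" where
  "enum_count n F \<epsilon> h \<alpha> = min (Cnt n F h \<alpha> (chosen_m n F \<epsilon> h \<alpha>)) (nat \<lceil>thresh \<epsilon>\<rceil>)"

definition round_config :: "real \<Rightarrow> bool \<times> real" where
  "round_config \<epsilon> =
     (if \<epsilon> < sqrt 2 - 1 then (True, sqrt (1 + 2 * \<epsilon>) / 2 * pivot \<epsilon>)
      else if \<epsilon> < 1 then (True, pivot \<epsilon> / sqrt 2)
      else if \<epsilon> < 3 then (True, pivot \<epsilon>)
      else if \<epsilon> < 4 * sqrt 2 - 1 then (False, pivot \<epsilon>)
      else (False, sqrt 2 * pivot \<epsilon>))"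

definition core_output ::
  "nat \<Rightarrow> cnf \<Rightarrow> real \<Rightarrow> (bool list \<Rightarrow> bool list) \<Rightarrow> bool list \<Rightarrow> real" where
  "core_output n F \<epsilon> h \<alpha> =
     (let m = chosen_m n F \<epsilon> h \<alpha>;
          c = enum_count n F \<epsilon> h \<alpha>;
          (roundUp, roundValue) = round_config \<epsilon>
      in if roundUp then 2 ^ m * max (real c) roundValue else 2 ^ m * roundValue)"

definition RoundMCCore ::
  "nat \<Rightarrow> (bool list \<Rightarrow> bool list) set \<Rightarrow> cnf \<Rightarrow> real \<Rightarrow> real pmf" where
  "RoundMCCore n H F \<epsilon> =
     do { h \<leftarrow> pmf_of_set H;
          \<alpha> \<leftarrow> pmf_of_set (bits n);
          return_pmf (core_output n F \<epsilon> h \<alpha>) }"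

lemma finite_bits: "finite (bits n)"
  using finite_lists_length_eq[of "UNIV :: bool set" n] by (simp add: bits_def)

lemma Cnt_0: "Cnt n F h \<alpha> 0 = card (sol n F)"
  by (simp add: Cnt_def cell_def)

lemma Cnt_antimono:
  assumes "i \<le> j"
  shows "Cnt n F h \<alpha> j \<le> Cnt n F h \<alpha> i"
  unfolding Cnt_def
proof (rule card_mono)
  show "finite (cell n F h \<alpha> i)"
    by (rule finite_subset[OF _ finite_bits[of n]]) (auto simp: cell_def sol_def)
  have "take i u = take i v" if "take j u = take j v" for u v :: "bool list"
    using arg_cong[OF that, of "take i"] assms by (simp add: min_absorb1)
  then show "cell n F h \<alpha> j \<subseteq> cell n F h \<alpha> i"
    unfolding cell_def by blast
qed

lemma is_crossing_unique:
  assumes "is_crossing n F \<epsilon> h \<alpha> i" "is_crossing n F \<epsilon> h \<alpha> j"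
  shows "i = j"
proof -
  have "\<not> i < j" if "is_crossing n F \<epsilon> h \<alpha> i" "is_crossing n F \<epsilon> h \<alpha> j" for i j
  proof
    assume "i < j"
    then have "i \<le> j - 1" by simp
    from Cnt_antimono[OF this, of n F h \<alpha>] that show False
      unfolding is_crossing_def by linarith
  qed
  with assms show ?thesis
    by (meson linorder_neqE_nat)
qed

lemma ex_crossing_iff:
  assumes "real (card (sol n F)) \<ge> thresh \<epsilon>"
  shows "(\<exists>m. is_crossing n F \<epsilon> h \<alpha> m) \<longleftrightarrow> real (Cnt n F h \<alpha> n) < thresh \<epsilon>"
proof
  assume "\<exists>m. is_crossing n F \<epsilon> h \<alpha> m"
  then obtain m where "m \<le> n" "real (Cnt n F h \<alpha> m) < thresh \<epsilon>"
    by (auto simp: is_crossing_def)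
  then show "real (Cnt n F h \<alpha> n) < thresh \<epsilon>"
    using Cnt_antimono[of m n n F h \<alpha>] by linarith
next
  let ?P = "\<lambda>m. real (Cnt n F h \<alpha> m) < thresh \<epsilon>"
  assume *: "?P n"
  define m where "m = (LEAST m. ?P m)"
  have "?P m"
    unfolding m_def using * by (rule LeastI)
  moreover have "m \<le> n"
    unfolding m_def using * by (rule Least_le)
  moreover have "m \<noteq> 0"
  proof
    assume "m = 0"
    with \<open>?P m\<close> assms show False by (simp add: Cnt_0)
  qed
  moreover have "\<not> ?P (m - 1)"
  proof -
    have "m - 1 < m" using \<open>m \<noteq> 0\<close> by simp
    then show ?thesis unfolding m_def by (rule not_less_Least)
  qed
  ultimately show "\<exists>m. is_crossing n F \<epsilon> h \<alpha> m"
    unfolding is_crossing_def by (intro exI[of _ m]) (simp add: not_less)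
qed

end

theory Submission
  imports Defs
begin

text \<open>
  Fix \<open>\<alpha>\<close>. By pairwise independence of \<open>h\<close>, the count at level \<open>k\<close> has mean \<open>\<mu>\<close> equal to
  \<open>|sol(F)| / 2^k\<close> and variance at most \<open>\<mu>\<close>, so Cantelli's inequality bounds both of its tails.
  Let \<open>M\<close> be the first level at which the mean is at most \<open>pivot\<close>; there the mean exceeds
  \<open>pivot / 2\<close>. With \<open>\<delta> = \<epsilon> / (1 + \<epsilon>)\<close> we have \<open>pivot * \<delta>^2 = 9.84\<close> and \<open>thresh = (1 + \<delta>) * pivot\<close>, so
  all tail bounds become numerical. A low output forces the procedure to stop at one of the levels
  below \<open>M\<close> that rounding does not repair: on the few levels nearest to \<open>M\<close> the count must fall
  below \<open>\<mu> / (1 + \<epsilon>)\<close>, and stopping at any lower level makes the count at a single fixed level fall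
  below \<open>thresh\<close> by monotonicity. A high output forces a large count at level \<open>M\<close>, or at level
  \<open>M + 1\<close> when the procedure always returns the rounded value. The bounds are uniform in \<open>\<alpha>\<close>.
\<close>

section \<open>One-sided Chebyshev inequality\<close>

theorem (in prob_space) Cantelli_inequality:
  assumes [measurable]: "random_variable borel f"
    and int: "integrable M (\<lambda>x. f x ^ 2)"
    and v: "variance f \<le> v" and "0 < v" and "0 < a"
  shows "prob {x \<in> space M. expectation f + a \<le> f x} \<le> v / (v + a\<^sup>2)"
proof -
  define \<mu> where "\<mu> = expectation f"
  have f: "integrable M f"
    using int by (blast intro: square_integrable_imp_integrable assms)
  \<comment> \<open>Markov's inequality is applied to the square of the deviation shifted by
    \<open>u\<close>; this \<open>u\<close> minimises the resulting bound
    \<open>(v + u\<^sup>2) / (a + u)\<^sup>2\<close>.\<close>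
  define u where "u = v / a"
  have u: "u > 0"
    using assms by (simp add: u_def)
  have sq: "(f x - \<mu> + u)\<^sup>2 = (f x - \<mu>)\<^sup>2 + 2 * u * (f x - \<mu>) + u\<^sup>2" for x
    by algebra
  have i1: "integrable M (\<lambda>x. (f x - \<mu>)\<^sup>2)"
    using int f unfolding power2_eq_square ring_distribs
    by (intro Bochner_Integration.integrable_diff) auto
  have i2: "integrable M (\<lambda>x. (f x - \<mu> + u)\<^sup>2)"
    unfolding sq using i1 f by (intro Bochner_Integration.integrable_add) auto
  have "expectation (\<lambda>x. (f x - \<mu> + u)\<^sup>2) = variance f + u\<^sup>2"
    unfolding sq using i1 f by (simp add: \<mu>_def prob_space)
  then have E: "expectation (\<lambda>x. (f x - \<mu> + u)\<^sup>2) \<le> v + u\<^sup>2"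
    using v by simp
  have "prob {x \<in> space M. \<mu> + a \<le> f x} \<le> prob {x \<in> space M. (a + u)\<^sup>2 \<le> (f x - \<mu> + u)\<^sup>2}"
    using u \<open>0 < a\<close> by (intro finite_measure_mono) (auto intro!: power_mono)
  also have "\<dots> \<le> expectation (\<lambda>x. (f x - \<mu> + u)\<^sup>2) / (a + u)\<^sup>2"
    using u \<open>0 < a\<close> by (intro integral_Markov_inequality_measure[where A = "{}"] i2) auto
  also have "\<dots> \<le> (v + u\<^sup>2) / (a + u)\<^sup>2"
    by (intro divide_right_mono E) auto
  also have "\<dots> = v / (v + a\<^sup>2)"
  proof -
    have "v + a\<^sup>2 > 0"
      using \<open>0 < v\<close> by (simp add: add_pos_nonneg)
    moreover have "v + u\<^sup>2 = v * (v + a\<^sup>2) / a\<^sup>2" and "a + u = (v + a\<^sup>2) / a"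
      using \<open>0 < a\<close> by (simp_all add: u_def field_simps power2_eq_square)
    ultimately show ?thesis
      using \<open>0 < a\<close> by (simp only: power_divide) (simp add: power2_eq_square)
  qed
  finally show ?thesis
    by (simp add: \<mu>_def)
qed

section \<open>Finiteness and counting of bit strings\<close>

lemma card_bits: "card (bits n) = 2 ^ n"
  using card_lists_length_eq[of "UNIV :: bool set" n] by (simp add: bits_def)

lemma card_bits_prefix:
  assumes "\<alpha> \<in> bits n" and "m \<le> n"
  shows "card {\<beta> \<in> bits n. take m \<beta> = take m \<alpha>} = 2 ^ (n - m)"
proof -
  have "bij_betw (\<lambda>z. take m \<alpha> @ z) (bits (n - m)) {\<beta> \<in> bits n. take m \<beta> = take m \<alpha>}"
    using assms by (intro bij_betwI[where g = "drop m"]) (auto simp: bits_def, metis append_take_drop_id)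
  then show ?thesis
    by (metis bij_betw_same_card card_bits)
qed

lemma finite_sol: "finite (sol n F)"
  by (rule finite_subset[OF _ finite_bits[of n]]) (auto simp: sol_def)

lemma card_sol_le: "card (sol n F) \<le> 2 ^ n"
  unfolding card_bits[symmetric] by (rule card_mono[OF finite_bits]) (auto simp: sol_def)

lemma finite_universal:
  assumes "strongly_2_universal n H"
  shows "finite H"
  using assms finite_PiE[OF finite_bits[of n], of "\<lambda>_. bits n"]
  by (auto simp: strongly_2_universal_def finite_bits intro: finite_subset)

section \<open>Moments and tails of a cell count for fixed \<alpha>\<close>

locale hashing =
  fixes n :: nat and H :: "(bool list \<Rightarrow> bool list) set" and \<alpha> :: "bool list"
  assumes universal: "strongly_2_universal n H"
    and n_pos: "1 \<le> n"
    and \<alpha>: "\<alpha> \<in> bits n"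
begin

abbreviation "P \<equiv> measure_pmf.prob (pmf_of_set H)"

abbreviation "match m y \<equiv> {h :: bool list \<Rightarrow> bool list. take m (h y) = take m \<alpha>}"

lemma set_hash: "set_pmf (pmf_of_set H) = H"
  using universal finite_universal[OF universal]
  by (simp add: strongly_2_universal_def)

lemma hash_bits: "h \<in> H \<Longrightarrow> y \<in> bits n \<Longrightarrow> h y \<in> bits n"
  using universal by (auto simp: strongly_2_universal_def)

lemma prob_value:
  assumes "x \<in> bits n" "\<beta> \<in> bits n"
  shows "P {h. h x = \<beta>} = 1 / 2 ^ n"
proof -
  \<comment> \<open>The universality condition speaks only about pairs of distinct points, so a
    second point must exist; this is where \<open>n_pos\<close> enters.\<close>
  obtain y where "y \<in> bits n" "x \<noteq> y"
  proof -
    have "replicate n True \<noteq> replicate n False"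
      using n_pos by (cases n) auto
    then show ?thesis
      using that[of "replicate n True"] that[of "replicate n False"]
      by (cases "x = replicate n True") (auto simp: bits_def)
  qed
  then show ?thesis
    using universal assms by (auto simp: strongly_2_universal_def)
qed

lemma prob_match:
  assumes "x \<in> bits n" "m \<le> n"
  shows "P (match m x) = 1 / 2 ^ m"
proof -
  let ?B = "{\<beta> \<in> bits n. take m \<beta> = take m \<alpha>}"
  \<comment> \<open>The two events agree only on the support: outside \<open>H\<close> a hash value
    need not lie in \<open>bits n\<close>.\<close>
  have "P (match m x) = P (\<Union>\<beta>\<in>?B. {h. h x = \<beta>})"
    using assms hash_bits by (intro measure_pmf.finite_measure_eq_AE) (auto simp: AE_measure_pmf_iff set_hash)
  also have "\<dots> = (\<Sum>\<beta>\<in>?B. P {h. h x = \<beta>})"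
    using finite_bits[of n] by (intro measure_pmf.finite_measure_finite_Union) (auto simp: disjoint_family_on_def)
  also have "\<dots> = real (card ?B) / 2 ^ n"
    using assms by (simp add: prob_value)
  also have "\<dots> = 1 / 2 ^ m"
    using assms by (simp add: card_bits_prefix[OF \<alpha>] field_simps flip: power_add)
  finally show ?thesis .
qed

lemma prob_match2:
  assumes "x \<in> bits n" "y \<in> bits n" "x \<noteq> y" "m \<le> n"
  shows "P (match m x \<inter> match m y) = 1 / 2 ^ m * (1 / 2 ^ m)"
proof -
  let ?B = "{\<beta> \<in> bits n. take m \<beta> = take m \<alpha>}"
  have "P (match m x \<inter> match m y) = P (\<Union>(\<beta>, \<gamma>)\<in>?B \<times> ?B. {h. h x = \<beta> \<and> h y = \<gamma>})"
    using assms hash_bits by (intro measure_pmf.finite_measure_eq_AE) (auto simp: AE_measure_pmf_iff set_hash)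
  also have "\<dots> = (\<Sum>(\<beta>, \<gamma>)\<in>?B \<times> ?B. P {h. h x = \<beta> \<and> h y = \<gamma>})"
    using finite_bits[of n] unfolding case_prod_unfold
    by (intro measure_pmf.finite_measure_finite_Union) (auto simp: disjoint_family_on_def)
  also have "\<dots> = (\<Sum>(\<beta>, \<gamma>)\<in>?B \<times> ?B. 1 / 2 ^ (2 * n))"
    using assms universal by (intro sum.cong) (auto simp: strongly_2_universal_def)
  also have "\<dots> = (real (card ?B) / 2 ^ n) * (real (card ?B) / 2 ^ n)"
    by (simp add: case_prod_unfold card_cartesian_product power_add mult_2)
  also have "real (card ?B) / 2 ^ n = 1 / 2 ^ m"
    using assms by (simp add: card_bits_prefix[OF \<alpha>] field_simps flip: power_add)
  finally show ?thesis .
qed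

lemma integrable_hash: "integrable (measure_pmf (pmf_of_set H)) (f :: _ \<Rightarrow> real)"
  using finite_universal[OF universal] by (intro integrable_measure_pmf_finite) (simp add: set_hash)

lemma Cnt_eq_sum: "real (Cnt n F h \<alpha> m) = (\<Sum>y\<in>sol n F. indicator (match m y) h)"
proof -
  have "(\<Sum>y\<in>sol n F. indicator (match m y) h) = (\<Sum>y\<in>sol n F. if take m (h y) = take m \<alpha> then 1 else 0 :: real)"
    by (intro sum.cong) (auto simp: indicator_def)
  also have "\<dots> = real (Cnt n F h \<alpha> m)"
    using finite_sol by (simp add: sum.If_cases Cnt_def cell_def Int_def)
  finally show ?thesis ..
qed

lemma expectation_Cnt:
  assumes "m \<le> n"
  shows "measure_pmf.expectation (pmf_of_set H) (\<lambda>h. real (Cnt n F h \<alpha> m)) = card (sol n F) / 2 ^ m"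
proof -
  have "y \<in> bits n" if "y \<in> sol n F" for y
    using that by (simp add: sol_def)
  then show ?thesis
    using assms by (simp add: Cnt_eq_sum Bochner_Integration.integral_sum integrable_hash prob_match)
qed

lemma variance_Cnt_le:
  assumes "m \<le> n"
  shows "measure_pmf.variance (pmf_of_set H) (\<lambda>h. real (Cnt n F h \<alpha> m)) \<le> card (sol n F) / 2 ^ m"
proof -
  let ?S = "sol n F" and ?q = "1 / 2 ^ m :: real"
  let ?E = "measure_pmf.expectation (pmf_of_set H)"
  have bits: "y \<in> bits n" if "y \<in> ?S" for y
    using that by (simp add: sol_def)
  have "?E (\<lambda>h. (real (Cnt n F h \<alpha> m))\<^sup>2)
      = ?E (\<lambda>h. \<Sum>x\<in>?S. \<Sum>y\<in>?S. indicator (match m x \<inter> match m y) h)"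
    by (simp add: Cnt_eq_sum power2_eq_square sum_product indicator_inter_arith)
  also have "\<dots> = (\<Sum>x\<in>?S. \<Sum>y\<in>?S. P (match m x \<inter> match m y))"
    by (simp add: Bochner_Integration.integral_sum integrable_hash)
  \<comment> \<open>Distinct pairs contribute exactly \<open>?q * ?q\<close>. Allowing that amount
    on the diagonal too completes the double sum to the squared mean plus the mean.\<close>
  also have "\<dots> \<le> (\<Sum>x\<in>?S. \<Sum>y\<in>?S. ?q * ?q + (if x = y then ?q else 0))"
  proof (intro sum_mono)
    fix x y assume "x \<in> ?S" "y \<in> ?S"
    then show "P (match m x \<inter> match m y) \<le> ?q * ?q + (if x = y then ?q else 0)"
      using prob_match[OF bits assms] prob_match2[OF bits bits _ assms] by (cases "x = y") auto
  qed
  also have "\<dots> = (card ?S / 2 ^ m)\<^sup>2 + card ?S / 2 ^ m"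
    using finite_sol[of n F] by (simp add: sum.distrib power2_eq_square distrib_left)
  finally show ?thesis
    unfolding measure_pmf.variance_eq[OF integrable_hash integrable_hash]
    by (simp add: expectation_Cnt[OF assms])
qed

text \<open>Replacing the true mean by the upper bound \<mu> is safe: it shrinks the gap to
  \<open>t\<close> and enlarges the variance bound.\<close>

lemma Cnt_upper_tail:
  fixes t :: real
  assumes "m \<le> n" and "card (sol n F) / 2 ^ m \<le> \<mu>" and "0 < \<mu>" and "\<mu> < t"
  shows "P {h. t \<le> Cnt n F h \<alpha> m} \<le> \<mu> / (\<mu> + (t - \<mu>)\<^sup>2)"
proof -
  let ?f = "\<lambda>h. real (Cnt n F h \<alpha> m)"
  have "P {h. t \<le> ?f h} \<le> P {h. card (sol n F) / 2 ^ m + (t - \<mu>) \<le> ?f h}"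
    using assms by (intro measure_pmf.finite_measure_mono) auto
  also have "\<dots> \<le> \<mu> / (\<mu> + (t - \<mu>)\<^sup>2)"
    using measure_pmf.Cantelli_inequality[of ?f "pmf_of_set H" \<mu> "t - \<mu>"]
      variance_Cnt_le[OF assms(1), of F] assms
    by (simp add: integrable_hash expectation_Cnt)
  finally show ?thesis .
qed

text \<open>Cantelli's inequality for the negated count. Here a larger mean widens the gap but also
  raises the variance bound, so passing to the lower bound \<mu> requires an argument.\<close>

lemma Cnt_lower_tail:
  fixes t :: real
  assumes "m \<le> n" and "\<mu> \<le> card (sol n F) / 2 ^ m" and "0 \<le> t" and "t < \<mu>"
  shows "P {h. Cnt n F h \<alpha> m \<le> t} \<le> \<mu> / (\<mu> + (\<mu> - t)\<^sup>2)"
proof -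
  let ?f = "\<lambda>h. real (Cnt n F h \<alpha> m)"
  define \<nu> where "\<nu> = card (sol n F) / 2 ^ m"
  have \<nu>: "\<mu> \<le> \<nu>" "t < \<nu>" "0 < \<nu>" "0 < \<mu>"
    using assms by (auto simp: \<nu>_def)
  have "P {h. ?f h \<le> t} = P {h. - \<nu> + (\<nu> - t) \<le> - ?f h}"
    by (rule arg_cong[of _ _ P]) auto
  also have "\<dots> \<le> \<nu> / (\<nu> + (\<nu> - t)\<^sup>2)"
    using measure_pmf.Cantelli_inequality[of "\<lambda>h. - ?f h" "pmf_of_set H" \<nu> "\<nu> - t"]
      variance_Cnt_le[OF assms(1), of F] \<nu> assms(1)
    by (simp add: integrable_hash expectation_Cnt \<nu>_def[symmetric] power2_commute)
  \<comment> \<open>The bound decreases in the mean once the mean exceeds \<open>t\<close>: after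
    cross-multiplication the difference factors as below.\<close>
  also have "\<dots> \<le> \<mu> / (\<mu> + (\<mu> - t)\<^sup>2)"
  proof -
    have "\<nu> * (\<mu> - t)\<^sup>2 \<le> \<mu> * (\<nu> - t)\<^sup>2"
    proof -
      have "\<mu> * (\<nu> - t)\<^sup>2 - \<nu> * (\<mu> - t)\<^sup>2 = (\<nu> - \<mu>) * (\<mu> * \<nu> - t * t)"
        by algebra
      moreover have "t * t \<le> \<mu> * \<nu>"
        using \<nu> assms by (intro mult_mono) auto
      ultimately show ?thesis
        using \<nu> by (metis diff_ge_0_iff_ge mult_nonneg_nonneg)
    qed
    moreover have "0 < \<nu> + (\<nu> - t)\<^sup>2" "0 < \<mu> + (\<mu> - t)\<^sup>2"
      using \<nu> by (simp_all add: add_pos_nonneg)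
    ultimately show ?thesis
      by (simp add: field_simps)
  qed
  finally show ?thesis .
qed

end

section \<open>Normalised parameters, the reference level and the stopping level\<close>

locale rounding = hashing +
  fixes F :: cnf and \<epsilon> :: real
  assumes eps: "0 < \<epsilon>"
    and large: "thresh \<epsilon> \<le> card (sol n F)"
begin

abbreviation "N \<equiv> real (card (sol n F))"

abbreviation "level h \<equiv> chosen_m n F \<epsilon> h \<alpha>"

abbreviation "cnt h k \<equiv> real (Cnt n F h \<alpha> k)"

abbreviation "roundUp \<equiv> fst (round_config \<epsilon>)"

abbreviation "roundValue \<equiv> snd (round_config \<epsilon>)"

definition \<delta> :: real where
  "\<delta> = \<epsilon> / (1 + \<epsilon>)"

lemma delta: "0 < \<delta>" "\<delta> < 1"
  using eps by (simp_all add: \<delta>_def)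

lemma one_minus_delta: "1 - \<delta> = 1 / (1 + \<epsilon>)"
  using eps by (simp add: \<delta>_def field_simps)

lemma pivot_delta: "pivot \<epsilon> * \<delta>\<^sup>2 = 9.84"
proof -
  have "(1 + 1 / \<epsilon>) * \<delta> = 1"
    using eps by (simp add: \<delta>_def divide_simps)
  then have "((1 + 1 / \<epsilon>) * \<delta>)\<^sup>2 = 1"
    by simp
  then show ?thesis
    by (simp add: pivot_def power_mult_distrib)
qed

lemma thresh_delta: "thresh \<epsilon> = (1 + \<delta>) * pivot \<epsilon>"
  by (simp add: thresh_def pivot_def \<delta>_def)

lemma pivot_ge: "9.84 \<le> pivot \<epsilon>"
proof -
  have "(1::real) \<le> (1 + 1 / \<epsilon>)\<^sup>2"
    using eps by (intro one_le_power) simp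
  then show ?thesis
    by (simp add: pivot_def)
qed

lemma pivot_gr: "9 < pivot \<epsilon>"
  by (rule less_le_trans[OF _ pivot_ge]) simp

lemma pivot_less_thresh: "pivot \<epsilon> < thresh \<epsilon>"
  using delta pivot_ge by (simp add: thresh_delta)

lemma sol_le: "N \<le> 2 ^ n"
  using card_sol_le[of n F] by (metis of_nat_le_iff of_nat_numeral of_nat_power)

definition M :: nat where
  "M = (LEAST m. N \<le> 2 ^ m * pivot \<epsilon>)"

text \<open>Level \<open>n\<close> is a witness for the minimum defining \<open>M\<close>, so
  \<open>M\<close> is well defined and at most \<open>n\<close>.\<close>

lemma N_le_pivot: "N \<le> 2 ^ n * pivot \<epsilon>"
proof -
  have "2 ^ n * 1 \<le> 2 ^ n * pivot \<epsilon>"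
    using pivot_ge by (intro mult_left_mono) auto
  then show ?thesis
    using sol_le by linarith
qed

lemma M_upper: "N \<le> 2 ^ M * pivot \<epsilon>"
  unfolding M_def by (rule LeastI[of "\<lambda>m. N \<le> 2 ^ m * pivot \<epsilon>" n]) (rule N_le_pivot)

lemma M_le: "M \<le> n"
  unfolding M_def by (rule Least_le) (rule N_le_pivot)

lemma M_lower: "2 ^ M * pivot \<epsilon> < 2 * N"
proof (cases M)
  \<comment> \<open>Contradictory: at level 0 the count would be at most \<open>pivot\<close>, hence
    below \<open>thresh\<close>.\<close>
  case 0
  then show ?thesis
    using M_upper large pivot_less_thresh by simp
next
  case (Suc k)
  then have "\<not> N \<le> 2 ^ k * pivot \<epsilon>"
    unfolding M_def by (intro not_less_Least) (simp add: M_def)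
  then show ?thesis
    by (simp add: Suc)
qed

lemma N_pos: "0 < N"
  using pivot_gr pivot_less_thresh large by linarith

lemma mean_lower:
  assumes "j \<le> M"
  shows "2 ^ j / 2 * pivot \<epsilon> \<le> N / 2 ^ (M - j)"
proof -
  have "(2::real) ^ M = 2 ^ j * 2 ^ (M - j)"
    using assms by (simp flip: power_add)
  then show ?thesis
    using M_lower by (simp add: field_simps)
qed

lemma level_le: "level h \<le> n"
proof (cases "\<exists>m. is_crossing n F \<epsilon> h \<alpha> m")
  case True
  then obtain m where "is_crossing n F \<epsilon> h \<alpha> m" ..
  moreover from this have "level h = m"
    using True is_crossing_unique by (auto simp: chosen_m_def intro!: the_equality)
  ultimately show ?thesis
    by (simp add: is_crossing_def)
qed (simp add: chosen_m_def)

lemma count_antimono: "i \<le> j \<Longrightarrow> cnt h j \<le> cnt h i"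
  by (simp add: Cnt_antimono)

text \<open>The second alternative covers the default level: if the chosen cell is still large,
  there is no crossing, and every cell is large by monotonicity.\<close>

lemma thresh_le_count:
  assumes "k < level h \<or> (k \<le> n \<and> thresh \<epsilon> \<le> cnt h (level h))"
  shows "thresh \<epsilon> \<le> cnt h k"
proof (cases "\<exists>m. is_crossing n F \<epsilon> h \<alpha> m")
  case True
  then obtain m where m: "is_crossing n F \<epsilon> h \<alpha> m" ..
  moreover from this have "level h = m"
    using True is_crossing_unique by (auto simp: chosen_m_def intro!: the_equality)
  ultimately show ?thesis
    using assms order_trans[OF _ count_antimono[of k "m - 1" h]] by (auto simp: is_crossing_def)
next
  case False
  then have "thresh \<epsilon> \<le> cnt h n" "level h = n"
    using ex_crossing_iff[OF large] by (auto simp: chosen_m_def not_less)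
  then show ?thesis
    using assms count_antimono[of k n h] by auto
qed

lemma enum_count_eq:
  assumes "cnt h (level h) < thresh \<epsilon>"
  shows "enum_count n F \<epsilon> h \<alpha> = Cnt n F h \<alpha> (level h)"
  using assms unfolding enum_count_def by linarith

lemma core_output_eq:
  "core_output n F \<epsilon> h \<alpha> =
     2 ^ level h * (if roundUp then max (enum_count n F \<epsilon> h \<alpha>) roundValue else roundValue)"
  by (simp add: core_output_def Let_def case_prod_unfold)

text \<open>A crude bound with two uses: estimates can be multiplied by \<open>roundValue\<close>,
  and the default level \<open>n\<close> cannot give a low output.\<close>

lemma one_le_roundValue: "1 \<le> roundValue"
proof -
  have "1 \<le> sqrt (1 + 2 * \<epsilon>)" "1 \<le> sqrt (2::real)" "sqrt 2 \<le> (2::real)"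
    using eps real_le_rsqrt[of 1 2] by (auto intro: real_le_lsqrt)
  moreover from this have "1 * (9.84 / 2) \<le> sqrt (1 + 2 * \<epsilon>) * (pivot \<epsilon> / 2)"
      "1 * 9.84 \<le> sqrt 2 * pivot \<epsilon>" "9.84 / 2 \<le> pivot \<epsilon> / sqrt 2"
    using pivot_ge eps by (intro mult_mono frac_le; simp)+
  ultimately show ?thesis
    using pivot_ge by (auto simp: round_config_def)
qed

section \<open>Low outputs and the stopping events behind them\<close>

lemma low_output:
  assumes "core_output n F \<epsilon> h \<alpha> < N / (1 + \<epsilon>)"
  shows "cnt h (level h) < thresh \<epsilon>"
    and "2 ^ level h * roundValue < N / (1 + \<epsilon>)"
    and "roundUp \<Longrightarrow> cnt h (level h) \<le> (1 - \<delta>) * (N / 2 ^ level h)"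
proof -
  have "2 ^ level h * roundValue \<le> core_output n F \<epsilon> h \<alpha>"
    unfolding core_output_eq by (intro mult_left_mono) auto
  with assms show rv: "2 ^ level h * roundValue < N / (1 + \<epsilon>)"
    by linarith
  \<comment> \<open>Otherwise the level is the default \<open>n\<close>, and
    \<open>2 ^ n * roundValue\<close> is already at least \<open>N\<close>.\<close>
  show *: "cnt h (level h) < thresh \<epsilon>"
  proof (rule ccontr)
    assume "\<not> cnt h (level h) < thresh \<epsilon>"
    then have "thresh \<epsilon> \<le> cnt h n"
      by (intro thresh_le_count) auto
    then have "level h = n"
      using ex_crossing_iff[OF large, of h \<alpha>] unfolding chosen_m_def by auto
    then have "N \<le> 2 ^ level h * 1"
      using sol_le by simp
    also have "\<dots> \<le> 2 ^ level h * roundValue"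
      using one_le_roundValue by (intro mult_left_mono) auto
    also note rv
    also have "N / (1 + \<epsilon>) \<le> N"
      using eps by (simp add: divide_le_eq distrib_left)
    finally show False by simp
  qed
  assume roundUp
  then have "2 ^ level h * cnt h (level h) \<le> core_output n F \<epsilon> h \<alpha>"
    unfolding core_output_eq by (simp add: enum_count_eq[OF *])
  with assms have "cnt h (level h) * 2 ^ level h \<le> (1 - \<delta>) * N"
    by (simp add: one_minus_delta mult.commute)
  then show "cnt h (level h) \<le> (1 - \<delta>) * (N / 2 ^ level h)"
    by (simp only: times_divide_eq_right pos_le_divide_eq zero_less_power zero_less_numeral)
qed

text \<open>The number \<open>j\<close> measures how far rounding reaches: at every level from
  \<open>M - j\<close> on, \<open>2 ^ level h * roundValue\<close> is at least
  \<open>N / (1 + \<epsilon>)\<close>.\<close>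

lemma low_output_level:
  assumes "core_output n F \<epsilon> h \<alpha> < N / (1 + \<epsilon>)"
    and "2 ^ j * pivot \<epsilon> \<le> roundValue * (1 + \<epsilon>)"
  shows "level h + Suc j \<le> M"
proof (rule ccontr)
  assume "\<not> level h + Suc j \<le> M"
  then have "(2::real) ^ M \<le> 2 ^ (level h + j)"
    by (intro power_increasing) auto
  then have "2 ^ M * pivot \<epsilon> \<le> 2 ^ (level h + j) * pivot \<epsilon>"
    using pivot_ge by (intro mult_right_mono) auto
  also have "\<dots> \<le> 2 ^ level h * (roundValue * (1 + \<epsilon>))"
    using assms(2) by (simp add: power_add)
  finally show False
    using M_upper low_output(2)[OF assms(1)] eps by (simp add: field_simps)
qed

text \<open>For mean \<mu> the deviation is \<open>\<delta> * \<mu>\<close>, so the tail is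
  \<open>1 / (1 + \<mu> * \<delta>\<^sup>2)\<close>; measuring \<mu> in units of
  \<open>pivot\<close> removes \<epsilon> through \<open>pivot_delta\<close>.\<close>

lemma prob_count_low:
  assumes "k \<le> n" "0 < q" "q * pivot \<epsilon> \<le> N / 2 ^ k"
  shows "P {h. cnt h k \<le> (1 - \<delta>) * (N / 2 ^ k)} \<le> 1 / (1 + 9.84 * q)"
proof -
  define \<mu> where "\<mu> = N / 2 ^ k"
  have \<mu>: "0 < \<mu>"
    using N_pos by (simp add: \<mu>_def)
  have "P {h. cnt h k \<le> (1 - \<delta>) * \<mu>} \<le> \<mu> / (\<mu> + (\<mu> - (1 - \<delta>) * \<mu>)\<^sup>2)"
    using assms \<mu> delta by (intro Cnt_lower_tail) (auto simp: \<mu>_def[symmetric] mult_less_cancel_right1)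
  also have "\<dots> = 1 / (1 + \<mu> * \<delta>\<^sup>2)"
  proof -
    have "\<mu> + (\<mu> - (1 - \<delta>) * \<mu>)\<^sup>2 = \<mu> * (1 + \<mu> * \<delta>\<^sup>2)"
      by (simp add: algebra_simps power2_eq_square)
    then show ?thesis
      using \<mu> by simp
  qed
  also have "\<dots> \<le> 1 / (1 + 9.84 * q)"
  proof -
    have "q * (pivot \<epsilon> * \<delta>\<^sup>2) \<le> \<mu> * \<delta>\<^sup>2"
      unfolding mult.assoc[symmetric] using assms by (intro mult_right_mono) (auto simp: \<mu>_def)
    then show ?thesis
      using assms unfolding pivot_delta by (intro frac_le) auto
  qed
  finally show ?thesis
    by (simp add: \<mu>_def)
qed

text \<open>With the mean at least \<open>q * pivot\<close>, the gap to \<open>thresh\<close> is at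
  least \<open>pivot * (q - 1 - \<delta>)\<close>. In normalised form the bound grows with \<delta>,
  so \<open>d\<close> is the worst case.\<close>

lemma prob_count_less_thresh:
  assumes "k \<le> n" "q * pivot \<epsilon> \<le> N / 2 ^ k" "\<delta> \<le> d" "1 + d < q"
  shows "P {h. cnt h k < thresh \<epsilon>} \<le> 1 / (1 + 9.84 * (((q - 1) / d - 1)\<^sup>2 / q))"
proof -
  define p where "p = pivot \<epsilon>"
  have p: "0 < p" "p * \<delta>\<^sup>2 = 9.84"
    using pivot_ge pivot_delta by (auto simp: p_def)
  have "P {h. cnt h k < thresh \<epsilon>} \<le> P {h. cnt h k \<le> thresh \<epsilon>}"
    by (intro measure_pmf.finite_measure_mono) auto
  also have "\<dots> \<le> q * p / (q * p + (q * p - thresh \<epsilon>)\<^sup>2)"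
    using assms delta p by (intro Cnt_lower_tail) (auto simp: p_def[symmetric] thresh_delta)
  also have "\<dots> = 1 / (1 + p * \<delta>\<^sup>2 * (((q - 1) / \<delta> - 1)\<^sup>2 / q))"
  proof -
    have "(q * p - thresh \<epsilon>)\<^sup>2 = q * p * (p * \<delta>\<^sup>2 * (((q - 1) / \<delta> - 1)\<^sup>2 / q))"
    proof -
      have "\<delta> * ((q - 1) / \<delta> - 1) = q - 1 - \<delta>"
        using delta by (simp add: field_simps)
      then have "\<delta>\<^sup>2 * ((q - 1) / \<delta> - 1)\<^sup>2 = (q - 1 - \<delta>)\<^sup>2"
        by (simp flip: power_mult_distrib)
      moreover have "q * p - thresh \<epsilon> = p * (q - 1 - \<delta>)"
        by (simp add: thresh_delta p_def algebra_simps)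
      moreover have "q \<noteq> 0"
        using assms delta by linarith
      ultimately show ?thesis
        by (simp add: power_mult_distrib) (simp add: power2_eq_square)
    qed
    then have "q * p + (q * p - thresh \<epsilon>)\<^sup>2 = q * p * (1 + p * \<delta>\<^sup>2 * (((q - 1) / \<delta> - 1)\<^sup>2 / q))"
      by (simp add: distrib_left)
    moreover have "q * p \<noteq> 0"
      using assms delta p by auto
    ultimately show ?thesis
      by (metis nonzero_mult_divide_mult_cancel_left mult.right_neutral)
  qed
  also have "\<dots> \<le> 1 / (1 + 9.84 * (((q - 1) / d - 1)\<^sup>2 / q))"
  proof -
    have "(q - 1) / d \<le> (q - 1) / \<delta>" "1 \<le> (q - 1) / d"
      using assms delta by (auto intro!: divide_left_mono)
    then have "((q - 1) / d - 1)\<^sup>2 / q \<le> ((q - 1) / \<delta> - 1)\<^sup>2 / q"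
      using assms delta by (intro divide_right_mono power_mono) auto
    moreover have "0 \<le> ((q - 1) / d - 1)\<^sup>2 / q"
      using assms delta by simp
    ultimately show ?thesis
      unfolding p by (intro frac_le) auto
  qed
  finally show ?thesis .
qed

definition light :: "nat \<Rightarrow> (bool list \<Rightarrow> bool list) set" where
  "light j = {h. level h + j = M \<and> cnt h (level h) \<le> (1 - \<delta>) * (N / 2 ^ level h)}"

text \<open>As in \<open>light\<close>, the level is compared additively, so the event is empty when
  \<open>j\<close> exceeds \<open>M\<close>; truncated subtraction would turn it into a statement
  about level 0.\<close>

definition early :: "nat \<Rightarrow> (bool list \<Rightarrow> bool list) set" where
  "early j = {h. level h + j \<le> M \<and> cnt h (level h) < thresh \<epsilon>}"

lemma prob_light:
  "P (light j) \<le> 1 / (1 + 9.84 * (2 ^ j / 2))"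
proof (cases "j \<le> M")
  case True
  have "light j \<subseteq> {h. cnt h (M - j) \<le> (1 - \<delta>) * (N / 2 ^ (M - j))}"
  proof
    fix h assume h: "h \<in> light j"
    then have "level h = M - j"
      by (auto simp: light_def)
    with h show "h \<in> {h. cnt h (M - j) \<le> (1 - \<delta>) * (N / 2 ^ (M - j))}"
      by (simp add: light_def)
  qed
  then have "P (light j) \<le> P {h. cnt h (M - j) \<le> (1 - \<delta>) * (N / 2 ^ (M - j))}"
    by (intro measure_pmf.finite_measure_mono) auto
  also have "\<dots> \<le> 1 / (1 + 9.84 * (2 ^ j / 2))"
    using mean_lower[OF True] M_le by (intro prob_count_low) auto
  finally show ?thesis .
next
  case False
  then have "light j = {}"
    by (auto simp: light_def)
  then show ?thesis by simp
qed

text \<open>Monotonicity charges all levels up to \<open>M - j\<close> to the single level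
  \<open>M - j\<close>, in place of a union bound over them.\<close>

lemma early_subset: "early j \<subseteq> {h. cnt h (M - j) < thresh \<epsilon>}"
proof
  fix h assume "h \<in> early j"
  then have "level h \<le> M - j" "cnt h (level h) < thresh \<epsilon>"
    by (auto simp: early_def intro: add_le_imp_le_diff)
  then show "h \<in> {h. cnt h (M - j) < thresh \<epsilon>}"
    using le_less_trans[OF count_antimono] by simp
qed

lemma prob_early:
  assumes "\<delta> \<le> d" "1 + d < 2 ^ j / 2"
  shows "P (early j) \<le> 1 / (1 + 9.84 * (((2 ^ j / 2 - 1) / d - 1)\<^sup>2 / (2 ^ j / 2)))"
proof (cases "j \<le> M")
  case True
  have "P (early j) \<le> P {h. cnt h (M - j) < thresh \<epsilon>}"
    using early_subset[of j] by (intro measure_pmf.finite_measure_mono) auto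
  also have "\<dots> \<le> 1 / (1 + 9.84 * (((2 ^ j / 2 - 1) / d - 1)\<^sup>2 / (2 ^ j / 2)))"
    using mean_lower[OF True] M_le assms by (intro prob_count_less_thresh) auto
  finally show ?thesis .
next
  case False
  then have "early j = {}"
    by (auto simp: early_def)
  then show ?thesis by simp
qed

abbreviation "low \<equiv> {h. core_output n F \<epsilon> h \<alpha> < N / (1 + \<epsilon>)}"

abbreviation "high \<equiv> {h. (1 + \<epsilon>) * N < core_output n F \<epsilon> h \<alpha>}"

lemma low_early:
  assumes "2 ^ j * pivot \<epsilon> \<le> roundValue * (1 + \<epsilon>)"
  shows "low \<subseteq> early (Suc j)"
  using low_output(1) low_output_level[OF _ assms] by (auto simp: early_def)

text \<open>Peels off one level: stopping exactly \<open>j\<close> below \<open>M\<close> forces a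
  relative deficit, because rounding up never returns less than the scaled count.\<close>

lemma low_light_early:
  assumes "roundUp"
  shows "low \<inter> early j \<subseteq> light j \<union> early (Suc j)"
  using low_output(3)[OF _ assms] by (auto simp: early_def light_def)

lemma prob_light_Un:
  assumes "A \<subseteq> light j \<union> B" and "P B \<le> b"
  shows "P A \<le> 1 / (1 + 9.84 * (2 ^ j / 2)) + b"
proof -
  have "P A \<le> P (light j \<union> B)"
    using assms by (intro measure_pmf.finite_measure_mono) auto
  also have "\<dots> \<le> P (light j) + P B"
    by (rule measure_Un_le) auto
  finally show ?thesis
    using prob_light[of j] assms by linarith
qed

section \<open>The lower error in the five ranges of \<epsilon>\<close>

lemma delta_le:
  assumes "\<epsilon> \<le> e"
  shows "\<delta> \<le> e / (1 + e)"
  using assms eps by (simp add: \<delta>_def field_simps)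

lemma sqrt2_bounds: "14142 / 10000 < sqrt 2" "sqrt 2 < 14143 / 10000"
  by (rule real_less_rsqrt real_less_lsqrt; simp add: power2_eq_square)+

lemma prob_early_2:
  assumes "\<epsilon> \<le> 1 / 2"
  shows "P (early 2) \<le> 0.05"
proof -
  have "\<delta> \<le> 1 / 3"
    using delta_le[OF assms] by simp
  then show ?thesis
    using prob_early[of "1/3" 2] by simp
qed

text \<open>If the mean at level \<open>M\<close> is small, \<open>roundValue\<close> alone rules out a low output at level \<open>M\<close>;
  otherwise all levels have larger means, which makes early stopping less likely.\<close>

lemma prob_low_less_sqrt2:
  assumes "\<epsilon> < sqrt 2 - 1"
  shows "P low \<le> 0.262"
proof (cases "2 * (N / 2 ^ M) \<le> sqrt (1 + 2 * \<epsilon>) * (1 + \<epsilon>) * pivot \<epsilon>")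
  have rv: "roundUp" "roundValue = sqrt (1 + 2 * \<epsilon>) / 2 * pivot \<epsilon>"
    using assms by (auto simp: round_config_def)
  case True
  have "low \<subseteq> early 1"
  proof
    fix h assume h: "h \<in> low"
    have "level h + 1 \<le> M"
    proof (rule ccontr)
      assume "\<not> level h + 1 \<le> M"
      then have "(2::real) ^ M \<le> 2 ^ level h"
        by (intro power_increasing) auto
      then have "2 ^ M * roundValue \<le> 2 ^ level h * roundValue"
        using one_le_roundValue by (intro mult_right_mono) auto
      moreover have "N / (1 + \<epsilon>) \<le> 2 ^ M * roundValue"
        using True eps unfolding rv by (simp add: field_simps)
      ultimately show False
        using low_output(2) h by fastforce
    qed
    then show "h \<in> early 1"
      using low_output(1) h by (auto simp: early_def)
  qed
  then have "low \<subseteq> light 1 \<union> early 2"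
    using low_light_early[OF rv(1), of 1] by (auto simp: numeral_2_eq_2)
  moreover have "\<epsilon> \<le> 1 / 2"
    using assms sqrt2_bounds by linarith
  then have "P (early 2) \<le> 0.05"
    by (rule prob_early_2)
  ultimately show ?thesis
    using prob_light_Un[of low 1 "early 2" "0.05"] by simp
next
  define s where "s = sqrt (1 + 2 * \<epsilon>)"
  have s: "1 \<le> s" "s\<^sup>2 = 1 + 2 * \<epsilon>"
    using eps by (auto simp: s_def)
  have s_le: "s \<le> 1 + \<epsilon>"
    unfolding s_def using eps by (intro real_le_lsqrt) (auto simp: power2_eq_square algebra_simps)
  have rv: "roundUp" "roundValue = s / 2 * pivot \<epsilon>"
    using assms by (auto simp: round_config_def s_def)
  case False
  then have mean: "s * (1 + \<epsilon>) * pivot \<epsilon> < 2 * (N / 2 ^ M)"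
    by (simp add: s_def)
  \<comment> \<open>From level \<open>M + 1\<close> on, rounding alone gives at least
    \<open>2 ^ M * pivot \<epsilon> * s\<close>, which is at least \<open>N\<close>; only levels up
    to \<open>M\<close> remain.\<close>
  have "low \<subseteq> early 0"
  proof
    fix h assume h: "h \<in> low"
    have "level h \<le> M"
    proof (rule ccontr)
      assume "\<not> level h \<le> M"
      then have "(2::real) ^ (M + 1) \<le> 2 ^ level h"
        by (intro power_increasing) auto
      then have "2 ^ (M + 1) * roundValue \<le> 2 ^ level h * roundValue"
        using one_le_roundValue by (intro mult_right_mono) auto
      moreover have "2 ^ (M + 1) * roundValue = 2 ^ M * pivot \<epsilon> * s"
        by (simp add: rv)
      moreover have "N * 1 \<le> 2 ^ M * pivot \<epsilon> * s"
        using M_upper s by (intro mult_mono) auto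
      moreover have "N / (1 + \<epsilon>) \<le> N"
        using eps by (simp add: divide_le_eq distrib_left)
      ultimately show False
        using low_output(2)[of h] h unfolding mem_Collect_eq by linarith
    qed
    then show "h \<in> early 0"
      using low_output(1) h by (auto simp: early_def)
  qed
  then have "low \<subseteq> light 0 \<union> early 1"
    using low_light_early[OF rv(1), of 0] by auto
  moreover have "P (early 1) \<le> 1 / 10.84"
  proof (cases "1 \<le> M")
    case True
    have pow: "(2::real) ^ M = 2 * 2 ^ (M - 1)"
      using True by (cases M) auto
    have "pivot \<epsilon> * 1 \<le> pivot \<epsilon> * (s * (1 + \<epsilon>))"
      using s eps pivot_gr mult_mono[of 1 s 1 "1 + \<epsilon>"] by (intro mult_left_mono) auto
    then have q: "1 * pivot \<epsilon> \<le> N / 2 ^ (M - 1)"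
      using mean by (simp add: pow mult_ac)
    \<comment> \<open>Here \<open>thresh\<close> is at most \<open>1 / (1 + \<epsilon>)\<close> times the mean at level \<open>M - 1\<close>, so the sharper
      relative tail bound already covers every level below \<open>M\<close>.\<close>
    have "early 1 \<subseteq> {h. cnt h (M - 1) \<le> (1 - \<delta>) * (N / 2 ^ (M - 1))}"
    proof -
      \<comment> \<open>Because
        \<open>1 + \<delta> = (1 + 2 * \<epsilon>) / (1 + \<epsilon>)\<close>, which is
        \<open>(1 - \<delta>) * s\<^sup>2\<close>.\<close>
      have "thresh \<epsilon> = (1 - \<delta>) * (s * s * pivot \<epsilon>)"
        using eps s by (simp add: thresh_delta \<delta>_def power2_eq_square field_simps)
      also have "s * s * pivot \<epsilon> \<le> s * (1 + \<epsilon>) * pivot \<epsilon>"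
        using s s_le pivot_gr by (intro mult_mono) auto
      also have "\<dots> \<le> N / 2 ^ (M - 1)"
        using mean by (simp add: pow)
      finally have "thresh \<epsilon> \<le> (1 - \<delta>) * (N / 2 ^ (M - 1))"
        using delta by simp
      then show ?thesis
        using early_subset[of 1] by auto
    qed
    then have "P (early 1) \<le> P {h. cnt h (M - 1) \<le> (1 - \<delta>) * (N / 2 ^ (M - 1))}"
      by (intro measure_pmf.finite_measure_mono) auto
    also have "\<dots> \<le> 1 / (1 + 9.84 * 1)"
      using q M_le by (intro prob_count_low) auto
    finally show ?thesis by simp
  qed (simp add: early_def)
  ultimately show ?thesis
    using prob_light_Un[of low 0 "early 1" "1 / 10.84"] by simp
qed

text \<open>Rounding repairs level \<open>M\<close>. Two levels are peeled off as
  \<open>light\<close> events and the rest is \<open>early 3\<close>: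
  \<open>1 / 10.84 + 1 / 20.68 + 1 / 62.5 < 0.157\<close>.\<close>

lemma prob_low_less_1:
  assumes "sqrt 2 - 1 \<le> \<epsilon>" "\<epsilon> < 1"
  shows "P low \<le> 0.157"
proof -
  have rv: "roundUp" "roundValue = pivot \<epsilon> / sqrt 2"
    using assms by (auto simp: round_config_def)
  have "2 ^ 0 * pivot \<epsilon> \<le> roundValue * (1 + \<epsilon>)"
  proof -
    have "pivot \<epsilon> * sqrt 2 \<le> pivot \<epsilon> * (1 + \<epsilon>)"
      using assms pivot_gr by (intro mult_left_mono) auto
    then show ?thesis
      by (simp add: rv field_simps)
  qed
  from low_early[OF this] have low: "low \<subseteq> light 1 \<union> (low \<inter> early 2)"
    using low_light_early[OF rv(1), of 1] by (auto simp: numeral_2_eq_2)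
  have "low \<inter> early 2 \<subseteq> light 2 \<union> early 3"
    using low_light_early[OF rv(1), of 2] by (simp add: numeral_3_eq_3 numeral_2_eq_2)
  moreover have "P (early 3) \<le> 1 / 62.5"
    using prob_early[of "1/2" 3] delta_le[of 1] assms by simp
  ultimately have "P (low \<inter> early 2) \<le> 1 / 20.68 + 1 / 62.5"
    using prob_light_Un[of "low \<inter> early 2" 2 "early 3" "1 / 62.5"] by simp
  from prob_light_Un[OF low this] show ?thesis
    by simp
qed

text \<open>Now \<open>1 + \<epsilon> \<ge> 2\<close>, so rounding also repairs level
  \<open>M - 1\<close> and the peeling starts one level lower.\<close>

lemma prob_low_less_3:
  assumes "1 \<le> \<epsilon>" "\<epsilon> < 3"
  shows "P low \<le> 0.085"
proof -
  have rv: "roundUp" "roundValue = pivot \<epsilon>"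
    using assms sqrt2_bounds by (auto simp: round_config_def)
  have "2 ^ 1 * pivot \<epsilon> \<le> roundValue * (1 + \<epsilon>)"
    using assms pivot_gr by (simp add: rv)
  from low_early[OF this] have low: "low \<subseteq> light 2 \<union> (low \<inter> early 3)"
    using low_light_early[OF rv(1), of 2] by (auto simp: numeral_2_eq_2 numeral_3_eq_3)
  have "low \<inter> early 3 \<subseteq> light 3 \<union> early 4"
    using low_light_early[OF rv(1), of 3] by (simp add: eval_nat_numeral)
  moreover have "P (early 4) \<le> 0.0117"
    using prob_early[of "3/4" 4] delta_le[of 3] assms by (simp add: power2_eq_square)
  ultimately have "P (low \<inter> early 3) \<le> 1 / 40.36 + 0.0117"
    using prob_light_Un[of "low \<inter> early 3" 3 "early 4" "0.0117"] by simp
  from prob_light_Un[OF low this] show ?thesis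
    by simp
qed

text \<open>Without rounding up the output depends on the level alone, so no relative deficit can be
  extracted. Rounding repairs levels down to \<open>M - 2\<close>, and \<open>early 3\<close>
  carries the whole error.\<close>

lemma prob_low_less_4_sqrt2:
  assumes "3 \<le> \<epsilon>" "\<epsilon> < 4 * sqrt 2 - 1"
  shows "P low \<le> 0.055"
proof -
  have rv: "roundValue = pivot \<epsilon>"
    using assms sqrt2_bounds by (auto simp: round_config_def)
  have "2 ^ 2 * pivot \<epsilon> \<le> roundValue * (1 + \<epsilon>)"
    using assms pivot_gr by (simp add: rv)
  then have "P low \<le> P (early 3)"
    using low_early[of 2] by (intro measure_pmf.finite_measure_mono) (auto simp: eval_nat_numeral)
  \<comment> \<open>This is \<open>4 * 1.4143 - 1\<close>, and \<open>46572 / 56572\<close> is the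
    matching bound on \<delta>.\<close>
  also have "\<epsilon> \<le> 4.6572"
    using assms sqrt2_bounds by simp
  then have "P (early 3) \<le> 0.055"
    using prob_early[of "46572/56572" 3] delta_le[of "4.6572"] by (simp add: power2_eq_square)
  finally show ?thesis .
qed

text \<open>Here \<open>roundValue * (1 + \<epsilon>)\<close> reaches
  \<open>8 * pivot \<epsilon>\<close>, one more repaired level. As \<epsilon> is unbounded, only
  \<delta> < 1 is available, hence \<open>d = 1\<close>.\<close>

lemma prob_low_ge_4_sqrt2:
  assumes "4 * sqrt 2 - 1 \<le> \<epsilon>"
  shows "P low \<le> 0.023"
proof -
  have rv: "roundValue = sqrt 2 * pivot \<epsilon>"
    using assms sqrt2_bounds by (auto simp: round_config_def)
  have "2 ^ 3 * pivot \<epsilon> \<le> roundValue * (1 + \<epsilon>)"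
  proof -
    have "sqrt 2 * pivot \<epsilon> * (4 * sqrt 2) \<le> sqrt 2 * pivot \<epsilon> * (1 + \<epsilon>)"
      using assms pivot_gr by (intro mult_left_mono) auto
    moreover have "sqrt 2 * pivot \<epsilon> * (4 * sqrt 2) = 8 * pivot \<epsilon>"
      by (simp add: algebra_simps)
    ultimately show ?thesis
      by (simp add: rv)
  qed
  then have "P low \<le> P (early 4)"
    using low_early[of 3] by (intro measure_pmf.finite_measure_mono) (auto simp: eval_nat_numeral)
  also have "P (early 4) \<le> 0.023"
    using prob_early[of 1 4] delta by simp
  finally show ?thesis .
qed

section \<open>The upper error\<close>

lemma high_level_thresh:
  assumes "k \<le> n" and "k < level h \<or> thresh \<epsilon> \<le> cnt h (level h)"
  shows "thresh \<epsilon> \<le> cnt h k"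
  using assms by (intro thresh_le_count) auto

lemma prob_high_roundUp:
  assumes "\<epsilon> < 3"
  shows "P high \<le> 0.169"
proof -
  define \<mu> where "\<mu> = N / 2 ^ M"
  have \<mu>: "pivot \<epsilon> / 2 < \<mu>" "\<mu> \<le> pivot \<epsilon>" "N = 2 ^ M * \<mu>"
    using M_lower M_upper by (auto simp: \<mu>_def field_simps)
  have "roundUp"
    using assms sqrt2_bounds by (auto simp: round_config_def)
  \<comment> \<open>Since the mean at \<open>M\<close> exceeds \<open>pivot / 2\<close>, this makes
    rounding harmless at all levels up to \<open>M\<close>.\<close>
  have rv: "2 * roundValue \<le> (1 + \<epsilon>) * pivot \<epsilon>"
  proof -
    have "sqrt (1 + 2 * \<epsilon>) \<le> 1 + \<epsilon>"
      using eps by (intro real_le_lsqrt) (auto simp: power2_eq_square algebra_simps)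
    moreover have "2 / sqrt 2 = sqrt 2"
      by (simp add: real_div_sqrt)
    then have "2 * (pivot \<epsilon> / sqrt 2) = sqrt 2 * pivot \<epsilon>"
      by (metis times_divide_eq_left times_divide_eq_right)
    ultimately show ?thesis
      using assms pivot_gr by (auto simp: round_config_def)
  qed
  \<comment> \<open>Stopping beyond \<open>M\<close> puts at least \<open>thresh\<close> in the cell
    at \<open>M\<close>. Stopping below \<open>M\<close> with a small cell cannot be high, as
    \<open>2 ^ level h\<close> is at most half of \<open>2 ^ M\<close>. At \<open>M\<close> itself
    the count must exceed \<open>(1 + \<epsilon>) * \<mu>\<close>.\<close>
  have high: "high \<subseteq> {h. (1 + \<delta>) * \<mu> \<le> cnt h M}"
  proof
    fix h assume h: "h \<in> high"
    have thr: "(1 + \<delta>) * \<mu> \<le> thresh \<epsilon>"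
      unfolding thresh_delta using delta \<mu> by (intro mult_left_mono) auto
    show "h \<in> {h. (1 + \<delta>) * \<mu> \<le> cnt h M}"
    proof (cases "M < level h \<or> thresh \<epsilon> \<le> cnt h (level h)")
      case True
      then have "thresh \<epsilon> \<le> cnt h M"
        using M_le by (intro high_level_thresh)
      with thr show ?thesis
        by simp
    next
      case False
      then have lev: "level h \<le> M" and few: "cnt h (level h) < thresh \<epsilon>"
        by auto
      have X: "(1 + \<epsilon>) * N < 2 ^ level h * max (cnt h (level h)) roundValue"
        using h \<open>roundUp\<close> by (simp add: core_output_eq enum_count_eq[OF few])
      have rv_no: "2 ^ level h * roundValue \<le> (1 + \<epsilon>) * N"
      proof -
        have "2 ^ level h * roundValue \<le> 2 ^ M * roundValue"
          using lev one_le_roundValue by (intro mult_right_mono power_increasing) auto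
        also have "\<dots> \<le> 2 ^ M * ((1 + \<epsilon>) * \<mu>)"
        proof (intro mult_left_mono)
          have "(1 + \<epsilon>) * (pivot \<epsilon> / 2) \<le> (1 + \<epsilon>) * \<mu>"
            using eps \<mu> by (intro mult_left_mono) auto
          with rv show "roundValue \<le> (1 + \<epsilon>) * \<mu>"
            by simp
        qed simp
        finally show ?thesis
          by (simp add: \<mu>(3) mult_ac)
      qed
      with X have cnt: "(1 + \<epsilon>) * N < 2 ^ level h * cnt h (level h)"
        by (auto simp: max_def split: if_splits)
      have "level h = M"
      proof (rule ccontr)
        assume "level h \<noteq> M"
        then have "(2::real) ^ (level h + 1) \<le> 2 ^ M"
          using lev by (intro power_increasing) auto
        then have "2 ^ level h * cnt h (level h) \<le> 2 ^ M / 2 * thresh \<epsilon>"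
          using few by (intro mult_mono) auto
        also have "\<dots> = (1 + \<delta>) * (2 ^ M * pivot \<epsilon> / 2)"
          by (simp add: thresh_delta)
        also have "\<dots> \<le> (1 + \<epsilon>) * N"
          using M_lower eps delta pivot_gr by (intro mult_mono) (auto simp: \<delta>_def divide_le_eq distrib_left)
        finally show False
          using cnt by simp
      qed
      then have "(1 + \<epsilon>) * \<mu> < cnt h M"
        using cnt unfolding \<mu>(3) by (simp add: mult.left_commute)
      moreover have "(1 + \<delta>) * \<mu> \<le> (1 + \<epsilon>) * \<mu>"
        using eps \<mu> pivot_gr by (intro mult_right_mono) (auto simp: \<delta>_def divide_le_eq distrib_left)
      ultimately show ?thesis
        by simp
    qed
  qed
  have "P high \<le> P {h. (1 + \<delta>) * \<mu> \<le> cnt h M}"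
    using high by (intro measure_pmf.finite_measure_mono) auto
  also have "\<dots> \<le> \<mu> / (\<mu> + ((1 + \<delta>) * \<mu> - \<mu>)\<^sup>2)"
    using delta \<mu> pivot_gr M_le by (intro Cnt_upper_tail) (auto simp: \<mu>_def[symmetric] mult_less_cancel_right1)
  also have "\<dots> = 1 / (1 + \<mu> * \<delta>\<^sup>2)"
  proof -
    have "\<mu> + ((1 + \<delta>) * \<mu> - \<mu>)\<^sup>2 = \<mu> * (1 + \<mu> * \<delta>\<^sup>2)"
      by (simp add: algebra_simps power2_eq_square)
    then show ?thesis
      using \<mu> pivot_gr by simp
  qed
  also have "\<dots> \<le> 1 / (1 + 9.84 / 2)"
  proof -
    have "pivot \<epsilon> / 2 * \<delta>\<^sup>2 \<le> \<mu> * \<delta>\<^sup>2"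
      using \<mu> by (intro mult_right_mono) auto
    then show ?thesis
      using pivot_delta by (intro frac_le) auto
  qed
  also have "\<dots> \<le> 0.169"
    by simp
  finally show ?thesis .
qed

lemma prob_high_roundDown:
  assumes "3 \<le> \<epsilon>"
  shows "P high \<le> 0.044"
proof -
  have "\<not> roundUp"
    using assms sqrt2_bounds by (auto simp: round_config_def)
  \<comment> \<open>The factor 4 makes even level \<open>M + 1\<close> safe, so a high output needs
    a count of at least \<open>thresh\<close> at \<open>M + 1\<close>, where the mean is at most
    \<open>pivot / 2\<close>.\<close>
  have rv: "4 * roundValue \<le> (1 + \<epsilon>) * pivot \<epsilon>"
  proof (cases "\<epsilon> < 4 * sqrt 2 - 1")
    case True
    then show ?thesis
      using assms sqrt2_bounds pivot_gr by (auto simp: round_config_def)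
  next
    case False
    then have "4 * sqrt 2 * pivot \<epsilon> \<le> (1 + \<epsilon>) * pivot \<epsilon>"
      using pivot_gr by (intro mult_right_mono) auto
    with False show ?thesis
      using assms sqrt2_bounds by (auto simp: round_config_def)
  qed
  have "h \<notin> high" if "level h \<le> M + 1" for h
  proof -
    have "2 ^ level h * roundValue \<le> 2 ^ (M + 1) * roundValue"
      using that one_le_roundValue by (intro mult_right_mono power_increasing) auto
    also have "\<dots> = 2 ^ M / 2 * (4 * roundValue)"
      by simp
    also have "\<dots> \<le> 2 ^ M / 2 * ((1 + \<epsilon>) * pivot \<epsilon>)"
      using rv by (intro mult_left_mono) auto
    also have "\<dots> = (1 + \<epsilon>) * (2 ^ M * pivot \<epsilon> / 2)"
      by simp
    also have "\<dots> \<le> (1 + \<epsilon>) * N"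
      using M_lower eps by (intro mult_left_mono) auto
    finally show ?thesis
      using \<open>\<not> roundUp\<close> by (simp add: core_output_eq)
  qed
  then have level: "M + 1 < level h" if "h \<in> high" for h
    using that by (meson not_less)
  show ?thesis
  proof (cases "M + 1 \<le> n")
    case True
    define p where "p = pivot \<epsilon>"
    have "3 / 4 \<le> \<delta>"
      using assms eps by (simp add: \<delta>_def field_simps)
    \<comment> \<open>From \<open>thresh = (1 + \<delta>) * pivot\<close> with \<delta> at least
      \<open>3 / 4\<close>.\<close>
    then have "7 / 4 * p \<le> thresh \<epsilon>"
      using pivot_gr by (simp add: thresh_delta p_def)
    then have "P high \<le> P {h. 7 / 4 * p \<le> cnt h (M + 1)}"
      using high_level_thresh[OF True] level by (intro measure_pmf.finite_measure_mono) (auto intro: order_trans)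
    also have "\<dots> \<le> p / 2 / (p / 2 + (7 / 4 * p - p / 2)\<^sup>2)"
      using True M_upper pivot_gr by (intro Cnt_upper_tail) (auto simp: p_def field_simps)
    also have "\<dots> = 1 / (1 + 25 / 8 * p)"
    proof -
      have "p / 2 + (7 / 4 * p - p / 2)\<^sup>2 = p / 2 * (1 + 25 / 8 * p)"
        by (simp add: algebra_simps power2_eq_square)
      then show ?thesis
        using pivot_gr by (simp only:) (simp add: p_def)
    qed
    also have "\<dots> \<le> 1 / (1 + 25 / 8 * 9)"
      using pivot_gr by (intro frac_le) (auto simp: p_def)
    also have "\<dots> \<le> 0.044"
      by simp
    finally show ?thesis .
  next
    case False
    then have "high = {}"
      using level level_le by (fastforce dest: less_le_trans)
    then show ?thesis by simp
  qed
qed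

lemma prob_low:
  "P low \<le> (if \<epsilon> < sqrt 2 - 1 then 0.262
              else if \<epsilon> < 1 then 0.157
              else if \<epsilon> < 3 then 0.085
              else if \<epsilon> < 4 * sqrt 2 - 1 then 0.055
              else 0.023)"
  using prob_low_less_sqrt2 prob_low_less_1 prob_low_less_3 prob_low_less_4_sqrt2 prob_low_ge_4_sqrt2 by (auto simp: not_less)

lemma prob_high:
  "P high \<le> (if \<epsilon> < 3 then 0.169 else 0.044)"
  using prob_high_roundUp prob_high_roundDown by (auto simp: not_less)

end

section \<open>Averaging over \<alpha>\<close>

lemma prob_bind_pmf_le:
  assumes "\<And>x. x \<in> set_pmf p \<Longrightarrow> measure_pmf.prob (f x) A \<le> c" and "0 \<le> c"
  shows "measure_pmf.prob (bind_pmf p f) A \<le> c"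
proof -
  have "emeasure (bind_pmf p f) A \<le> (\<integral>\<^sup>+x. ennreal c \<partial>measure_pmf p)"
    unfolding emeasure_bind_pmf using assms
    by (intro nn_integral_mono_AE) (auto simp: AE_measure_pmf_iff measure_pmf.emeasure_eq_measure)
  then show ?thesis
    using assms(2) by (simp add: measure_pmf.emeasure_eq_measure)
qed

text \<open>The two draws are independent and commute, so \<alpha> can be drawn first and a bound
  uniform in \<alpha> survives averaging.\<close>

lemma prob_RoundMCCore_le:
  assumes "\<And>\<alpha>. \<alpha> \<in> bits n \<Longrightarrow>
      measure_pmf.prob (pmf_of_set H) {h. core_output n F \<epsilon> h \<alpha> \<in> A} \<le> c" and "0 \<le> c"
  shows "measure_pmf.prob (RoundMCCore n H F \<epsilon>) A \<le> c"
proof -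
  have "bits n \<noteq> {}"
    by (metis card.empty card_bits power_not_zero zero_neq_numeral)
  then have set: "set_pmf (pmf_of_set (bits n)) = bits n"
    using finite_bits by simp
  have "RoundMCCore n H F \<epsilon> =
      bind_pmf (pmf_of_set (bits n)) (\<lambda>\<alpha>. map_pmf (\<lambda>h. core_output n F \<epsilon> h \<alpha>) (pmf_of_set H))"
    unfolding RoundMCCore_def map_pmf_def by (subst bind_commute_pmf) simp
  then show ?thesis
    using assms by (auto intro!: prob_bind_pmf_le simp: set vimage_def)
qed

theorem lemma4:
  fixes n :: nat and F :: cnf and H :: "(bool list \<Rightarrow> bool list) set" and \<epsilon> :: real
  assumes "cnf_on n F"
    and "strongly_2_universal n H"
    and "\<epsilon> > 0"
    and "real (card (sol n F)) \<ge> thresh \<epsilon>"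
  shows "measure_pmf.prob (RoundMCCore n H F \<epsilon>) {X. X < real (card (sol n F)) / (1 + \<epsilon>)}
           \<le> (if \<epsilon> < sqrt 2 - 1 then 0.262
              else if \<epsilon> < 1 then 0.157
              else if \<epsilon> < 3 then 0.085
              else if \<epsilon> < 4 * sqrt 2 - 1 then 0.055
              else 0.023) \<and>
         measure_pmf.prob (RoundMCCore n H F \<epsilon>) {X. X > (1 + \<epsilon>) * real (card (sol n F))}
           \<le> (if \<epsilon> < 3 then 0.169 else 0.044)"
proof -
  \<comment> \<open>Forces at least two solutions and hence \<open>n \<ge> 1\<close>, as the locale
    demands.\<close>
  have "1 < thresh \<epsilon>"
  proof -
    have "(1::real) \<le> (1 + 1 / \<epsilon>)\<^sup>2" "1 \<le> 1 + \<epsilon> / (1 + \<epsilon>)"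
      using assms(3) by (auto intro: one_le_power)
    then have "9.84 * 1 * 1 \<le> thresh \<epsilon>"
      unfolding thresh_def by (intro mult_mono) auto
    then show ?thesis
      by simp
  qed
  then have "1 < card (sol n F)"
    using assms(4) by linarith
  then have "1 \<le> n"
    using card_sol_le[of n F] by (cases n) auto
  then have "rounding n H \<alpha> F \<epsilon>" if "\<alpha> \<in> bits n" for \<alpha>
    using that assms by unfold_locales
  then show ?thesis
    using rounding.prob_low rounding.prob_high
    by (intro conjI prob_RoundMCCore_le) (simp_all split del: if_split, simp_all)
qed

end
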